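(* Let $n \ge 4$ be an even integer and let $T_{2n}(W)$ be the Toeplitz graph with vertex set $\{x_1,\dots,x_{2n}\}$ in which $x_i$ and $x_j$ are adjacent if and only if $|i-j|$ is odd or $|i-j| = n$. Then the $1$-domination number satisfies $\gamma_1(T_{2n}(W)) = 2$.
   Context: $T_{2n}(W)$ is defined from $W = \{x_1, x_3, \dots, x_{2n-1}\} \cup \{x_n\}$: distinct vertices $x_i, x_j$ ($1\le i,j\le 2n$) are adjacent iff $|i-j| = t$ for some $x_t \in W$, i.e. iff $|i-j|$ is odd or equals $n$. For a graph $G$ and an integer $k\ge 1$, a subset $D \subseteq V(G)$ is a $k$-dominating set if every vertex of $V(G)\setminus D$ has at least $k$ neighbors in $D$. The $k$-domination number $\gamma_k(G)$ is the minimum cardinality of a $k$-dominating set of $G$. *)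

theory Defs
  imports "Graph_Theory.Pair_Digraph"
begin

text \<open>
  An undirected simple graph is represented, as in the library locale \<^locale>\<open>pair_graph\<close>,
  by a finite loop-free symmetric digraph, so an edge is a pair of opposite arcs.
\<close>

definition k_dominating_set :: "('a, 'b) pre_digraph \<Rightarrow> nat \<Rightarrow> 'a set \<Rightarrow> bool" where
  "k_dominating_set G k D \<longleftrightarrow>
     D \<subseteq> verts G \<and> (\<forall>v \<in> verts G - D. k \<le> card {u \<in> D. v \<rightarrow>\<^bsub>G\<^esub> u})"

text \<open>
  For finite \<open>G\<close> the minimum exists, since \<^term>\<open>verts G\<close> is vacuously \<open>k\<close>-dominating.
\<close>

definition k_domination_number :: "nat \<Rightarrow> ('a, 'b) pre_digraph \<Rightarrow> nat" where
  "k_domination_number k G = Min (card ` {D. k_dominating_set G k D})"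

text \<open>
  The vertex \<open>x\<^sub>i\<close> is represented by its index \<open>i\<close>, and a set \<open>W\<close> of vertices by
  the set of their indices.
\<close>

definition toeplitz_graph :: "nat \<Rightarrow> nat set \<Rightarrow> nat pair_pre_digraph" where
  "toeplitz_graph m W =
     \<lparr> pverts = {1..m},
       parcs = {(i, j). i \<in> {1..m} \<and> j \<in> {1..m} \<and> i \<noteq> j \<and>
                        (\<exists>t \<in> W. \<bar>int i - int j\<bar> = int t)} \<rparr>"

definition odd_or_half :: "nat \<Rightarrow> nat set" where
  "odd_or_half n = {t \<in> {1..2 * n - 1}. odd t} \<union> {n}"

lemma pair_graph_toeplitz_graph: "pair_graph (toeplitz_graph m W)"
proof
  show "finite (parcs (toeplitz_graph m W))"
    by (rule finite_subset[of _ "{1..m} \<times> {1..m}"]) (auto simp: toeplitz_graph_def)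
  show "symmetric (with_proj (toeplitz_graph m W))"
    by (auto simp: symmetric_def sym_def toeplitz_graph_def arcs_ends_def arc_to_ends_def
        abs_minus_commute)
qed (auto simp: toeplitz_graph_def)

lemma toeplitz_graph_odd_or_half_adj:
  assumes "i \<in> {1..2 * n}" "j \<in> {1..2 * n}" "i \<noteq> j"
  shows "i \<rightarrow>\<^bsub>with_proj (toeplitz_graph (2 * n) (odd_or_half n))\<^esub> j \<longleftrightarrow>
         odd \<bar>int i - int j\<bar> \<or> \<bar>int i - int j\<bar> = int n"
proof -
  define d where "d = nat \<bar>int i - int j\<bar>"
  have d: "\<bar>int i - int j\<bar> = int d" "1 \<le> d" "d \<le> 2 * n - 1"
    using assms by (auto simp: d_def)
  have "i \<rightarrow>\<^bsub>with_proj (toeplitz_graph (2 * n) (odd_or_half n))\<^esub> j \<longleftrightarrow> d \<in> odd_or_half n"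
    using assms d by (auto simp: toeplitz_graph_def arcs_ends_def arc_to_ends_def)
  then show ?thesis
    unfolding d(1) using d(2,3) by (auto simp: odd_or_half_def)
qed

end

theory Submission
  imports Defs
begin

text \<open>Odd distance always gives an edge, so any two vertices of opposite parity are adjacent;
  the pair {1, 2} contains one vertex of each parity and therefore dominates. A single vertex
  cannot: some vertex lies at distance 2 from it, and 2 is neither odd nor equal to
  \<open>n\<close>, as \<open>n\<close> is at least 4 (\<open>ex_nonadjacent_toeplitz\<close>). The
  empty set fails trivially, so the minimum is 2.\<close>

text \<open>Finiteness matters because \<open>card\<close> of an infinite set is 0, which would hide
  existing neighbors.\<close>

lemma k_dominating_set_1_iff:
  assumes "finite (verts G)"
  shows "k_dominating_set G 1 D \<longleftrightarrow>
    D \<subseteq> verts G \<and> (\<forall>v \<in> verts G - D. \<exists>u \<in> D. v \<rightarrow>\<^bsub>G\<^esub> u)"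
proof (cases "D \<subseteq> verts G")
  case True
  then have "finite D"
    using assms finite_subset by blast
  then have "1 \<le> card {u \<in> D. v \<rightarrow>\<^bsub>G\<^esub> u} \<longleftrightarrow> (\<exists>u \<in> D. v \<rightarrow>\<^bsub>G\<^esub> u)" for v
    by (auto simp: Suc_le_eq card_gt_0_iff)
  with True show ?thesis
    unfolding k_dominating_set_def by blast
qed (simp add: k_dominating_set_def)

text \<open>Finitely many vertices leave finitely many candidate sets, so \<open>Min\<close> is a
  true minimum and a witness with a matching lower bound determines it.\<close>

lemma k_domination_number_eqI:
  assumes "finite (verts G)" and "k_dominating_set G k D" and "card D = m"
    and "\<And>D'. k_dominating_set G k D' \<Longrightarrow> m \<le> card D'"
  shows "k_domination_number k G = m"
proof -
  have "{D. k_dominating_set G k D} \<subseteq> Pow (verts G)"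
    by (auto simp: k_dominating_set_def)
  then have "finite {D. k_dominating_set G k D}"
    using assms(1) finite_subset by blast
  then show ?thesis
    unfolding k_domination_number_def using assms(2-4) by (intro Min_eqI) auto
qed

lemma ex_nonadjacent_toeplitz:
  assumes "n \<ge> 4" and d: "d \<in> {1..2 * n}"
  shows "\<exists>v \<in> {1..2 * n}. v \<noteq> d \<and>
    \<not> v \<rightarrow>\<^bsub>with_proj (toeplitz_graph (2 * n) (odd_or_half n))\<^esub> d"
proof -
  \<comment> \<open>Step two places up, or down when that would leave the range; in the latter case
    \<open>d\<close> exceeds 2 * n - 2, so \<open>d - 2\<close> is still positive.\<close>
  define v where "v = (if d + 2 \<le> 2 * n then d + 2 else d - 2)"
  have v: "v \<in> {1..2 * n}" "v \<noteq> d" and dist: "\<bar>int v - int d\<bar> = 2"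
    using assms by (auto simp: v_def)
  show ?thesis
    using v assms(1) toeplitz_graph_odd_or_half_adj[OF v(1) d v(2)] dist by auto
qed

theorem proposition3p14:
  fixes n :: nat
  assumes "n \<ge> 4" and "even n"
  shows "k_domination_number 1 (with_proj (toeplitz_graph (2 * n) (odd_or_half n))) = 2"
proof -
  let ?G = "with_proj (toeplitz_graph (2 * n) (odd_or_half n))"
  have verts: "verts ?G = {1..2 * n}"
    by (simp add: toeplitz_graph_def)
  then have fin: "finite (verts ?G)"
    by simp
  show ?thesis
  proof (rule k_domination_number_eqI[OF fin])
    show "k_dominating_set ?G 1 {1, 2}"
      unfolding k_dominating_set_1_iff[OF fin] verts
    proof (intro conjI ballI)
      show "{1, 2} \<subseteq> {1..2 * n}"
        using assms(1) by auto
      fix v assume v: "v \<in> {1..2 * n} - {1, 2}"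
      show "\<exists>u \<in> {1, 2}. v \<rightarrow>\<^bsub>?G\<^esub> u"
        \<comment> \<open>An even \<open>v\<close> is at odd distance from 1, an odd
          \<open>v\<close> from 2.\<close>
        using v assms(1) toeplitz_graph_odd_or_half_adj[of v n 1]
          toeplitz_graph_odd_or_half_adj[of v n 2]
        by (cases "even v") auto
    qed
  next
    fix D assume "k_dominating_set ?G 1 D"
    then have D: "D \<subseteq> {1..2 * n}"
      and dom: "\<And>v. v \<in> {1..2 * n} \<Longrightarrow> v \<notin> D \<Longrightarrow> \<exists>u \<in> D. v \<rightarrow>\<^bsub>?G\<^esub> u"
      unfolding k_dominating_set_1_iff[OF fin] verts by auto
    have "finite D"
      using D finite_subset by blast
    moreover have "D \<noteq> {}"
      using dom[of 1] assms(1) by auto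
    \<comment> \<open>A vertex not adjacent to \<open>d\<close> would be left undominated.\<close>
    moreover have "D \<noteq> {d}" for d
      using D dom ex_nonadjacent_toeplitz[OF assms(1), of d] by auto
    ultimately have "card D \<noteq> 0" "card D \<noteq> 1"
      by (auto simp: card_1_singleton_iff)
    then show "2 \<le> card D"
      by linarith
  qed simp
qed

end
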